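(* For all $W > 1$ and $\beta > 0$ we have $$\bigg| \int_1^W \frac{J_1\big(\beta \sqrt{\nu^2 - 1}\big)}{\sqrt{\nu^2 - 1}}\, \mathrm{d}\nu \bigg| \le \frac{1 - \mathrm{e}^{-\beta}}{\beta} + \frac{\sqrt{2}\, \pi}{\sqrt{\beta}},$$ where $J_1$ denotes the Bessel function of first order.
   Context: $J_1$ is the Bessel function of the first kind of order $1$. *)

theory Defs
  imports "HOL-Analysis.Analysis"
begin

definition bessel_J :: "nat \<Rightarrow> real \<Rightarrow> real" where
  "bessel_J n x = (\<Sum>m. (- 1) ^ m / (fact m * fact (m + n)) * (x / 2) ^ (2 * m + n))"

lemma summable_bessel_aux:
  fixes y :: real
  shows "summable (\<lambda>m. (- 1) ^ m / (fact m * fact (m + n)) * y ^ m)"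
proof (rule summable_comparison_test[OF _ summable_norm_exp[of y]], intro exI allI impI)
  fix m :: nat
  show "norm ((- 1) ^ m / (fact m * fact (m + n)) * y ^ m) \<le> norm (y ^ m /\<^sub>R fact m)"
    using mult_right_mono[of 1 "fact (m + n) :: real" "\<bar>y\<bar> ^ m"]
    by (simp add: abs_mult power_abs divide_simps mult.commute)
qed

lemma bessel_J_eq:
  "bessel_J n x = (x / 2) ^ n * (\<Sum>m. (- 1) ^ m / (fact m * fact (m + n)) * ((x / 2)\<^sup>2) ^ m)"
  unfolding bessel_J_def
  by (subst suminf_mult[OF summable_bessel_aux, symmetric])
     (simp add: power_add mult_ac flip: power_mult)

lemma summable_bessel_J:
  "summable (\<lambda>m. (- 1) ^ m / (fact m * fact (m + n)) * (x / 2 :: real) ^ (2 * m + n))"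
  using summable_mult[OF summable_bessel_aux[of n "(x / 2)\<^sup>2"], of "(x / 2) ^ n"]
  by (simp add: power_add mult_ac flip: power_mult)

text \<open>
  The singularity at \<open>\<nu> = 1\<close> is removable, so the integral in the theorem is a genuine one
  and not the default value of \<^const>\<open>integral\<close>.
\<close>

lemma bessel_J_integrand_integrable:
  fixes W \<beta> :: real
  shows "(\<lambda>\<nu>. bessel_J 1 (\<beta> * sqrt (\<nu>\<^sup>2 - 1)) / sqrt (\<nu>\<^sup>2 - 1)) integrable_on {1..W}"
proof -
  define g :: "real \<Rightarrow> real" where "g y = (\<Sum>m. (- 1) ^ m / (fact m * fact (m + 1)) * y ^ m)" for y
  have "isCont g y" for y
    unfolding g_def[abs_def]
    by (rule isCont_powser[OF summable_bessel_aux[of 1 "\<bar>y\<bar> + 1"]]) auto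
  then have cont: "continuous_on UNIV g"
    by (simp add: continuous_at_imp_continuous_on)
  have "(\<lambda>\<nu>. \<beta> / 2 * g ((\<beta> * sqrt (\<nu>\<^sup>2 - 1) / 2)\<^sup>2)) integrable_on {1..W}"
    by (intro integrable_continuous_real continuous_intros continuous_on_compose2[OF cont]) auto
  then show ?thesis
  proof (rule integrable_spike_finite[of "{1}", rotated 2])
    fix \<nu> assume "\<nu> \<in> {1..W} - {1}"
    then have "\<nu>\<^sup>2 - 1 > 0" by (auto simp: one_less_power)
    then show "bessel_J 1 (\<beta> * sqrt (\<nu>\<^sup>2 - 1)) / sqrt (\<nu>\<^sup>2 - 1)
        = \<beta> / 2 * g ((\<beta> * sqrt (\<nu>\<^sup>2 - 1) / 2)\<^sup>2)"
      unfolding bessel_J_eq g_def by simp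
  qed simp
qed

end

theory Submission
  imports Defs
begin

text \<open>
  The estimate rests on \<open>J\<^sub>0' = - J\<^sub>1\<close> and on the two elementary bounds \<open>\<bar>J\<^sub>0(x)\<bar> \<le> 1\<close>
  and \<open>\<bar>J\<^sub>1(x)\<bar> \<le> x / 2\<close> for \<open>x \<ge> 0\<close>.

  Put \<open>K(\<nu>) = J\<^sub>0(\<beta> \<surd>(\<nu>\<^sup>2 - 1))\<close>.  By the chain rule the integrand is \<open>- K'(\<nu>) / (\<beta> \<nu>)\<close>: an
  exact derivative times a positive decreasing weight.  Since \<open>\<bar>K\<bar> \<le> 1\<close>, an integration by parts
  bounds its integral over \<open>[a, W]\<close> by \<open>2 / (\<beta> a)\<close>, however large \<open>W\<close> is
  (\<open>bessel_integral_tail\<close>).  On the other hand the integrand itself is at most \<open>\<beta> / 2\<close>, so that its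
  integral over \<open>[1, a]\<close> is at most \<open>\<beta> (a - 1) / 2\<close>.  The choice \<open>a = 1\<close> for \<open>\<beta> \<ge> 1\<close> gives the
  bound \<open>2 / \<beta>\<close>; for \<open>\<beta> \<le> 1\<close> the choice \<open>a = 2 / \<beta>\<close> makes both parts at most \<open>1\<close>.  In either case
  the integral is at most \<open>2 / max 1 \<beta> \<le> 2 / \<surd>\<beta>\<close>.  This is below the second term of the claimed
  bound because \<open>2 \<le> \<surd>2 \<pi>\<close>, and the first term is nonnegative.

  Both bounds on Bessel functions come from an energy argument.  The computation is done for the
  entire functions \<open>g\<^sub>n\<close> with \<open>J\<^sub>n(x) = (x / 2)\<^sup>n g\<^sub>n((x / 2)\<^sup>2)\<close>, which have no square root and no
  singularity at \<open>\<nu> = 1\<close>.  They satisfy \<open>g\<^sub>n' = - g\<^sub>n\<^sub>+\<^sub>1\<close> and \<open>y g\<^sub>n'' + (n + 1) g\<^sub>n' + g\<^sub>n = 0\<close>, and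
  the energy \<open>g\<^sub>n\<^sup>2 + y g\<^sub>n'\<^sup>2\<close> is then decreasing on \<open>[0, \<infinity>)\<close>, which gives \<open>\<bar>g\<^sub>n(y)\<bar> \<le> 1 / n!\<close>
  there (\<open>bessel_clifford_bound\<close>).
\<close>

text \<open>
  The Bessel--Clifford function of order \<open>n\<close>, evaluated at \<open>- y\<close>; the sign is chosen so that the
  real Bessel functions correspond to \<open>y \<ge> 0\<close>.
\<close>

definition bessel_clifford :: "nat \<Rightarrow> real \<Rightarrow> real" where
  "bessel_clifford n y = (\<Sum>m. (- 1) ^ m / (fact m * fact (m + n)) * y ^ m)"

lemma bessel_J_conv_clifford: "bessel_J n x = (x / 2) ^ n * bessel_clifford n ((x / 2)\<^sup>2)"
  unfolding bessel_clifford_def by (rule bessel_J_eq)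

lemma bessel_clifford_0 [simp]: "bessel_clifford n 0 = 1 / fact n"
  unfolding bessel_clifford_def
  using powser_sums_zero[of "\<lambda>m. (- 1) ^ m / (fact m * fact (m + n)) :: real"]
  by (simp add: sums_iff)

lemma has_real_derivative_bessel_clifford:
  "(bessel_clifford n has_real_derivative - bessel_clifford (Suc n) y) (at y)"
proof -
  define c :: "nat \<Rightarrow> nat \<Rightarrow> real" where "c n m = (- 1) ^ m / (fact m * fact (m + n))" for n m
  have summable: "summable (\<lambda>m. c n m * y ^ m)" for n y
    unfolding c_def by (rule summable_bessel_aux)
  have "diffs (c n) m = - c (Suc n) m" for m
    unfolding diffs_def c_def fact_Suc[of m] power_Suc by (simp del: of_nat_Suc fact_Suc)
  then have "(\<Sum>m. diffs (c n) m * y ^ m) = - (\<Sum>m. c (Suc n) m * y ^ m)"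
    by (simp add: suminf_minus summable)
  with termdiffs_strong_converges_everywhere[of "c n" y] show ?thesis
    unfolding bessel_clifford_def[abs_def] c_def[symmetric] by (simp add: summable)
qed

lemmas bessel_clifford_derivative [derivative_intros] =
  DERIV_chain2[OF has_real_derivative_bessel_clifford]

lemma continuous_on_bessel_clifford [continuous_intros]:
  assumes "continuous_on A f"
  shows "continuous_on A (\<lambda>x. bessel_clifford n (f x))"
  by (rule continuous_on_compose2[OF _ assms, of UNIV])
    (auto intro: DERIV_continuous_on has_real_derivative_bessel_clifford)

text \<open>
  Since \<open>g\<^sub>n' = - g\<^sub>n\<^sub>+\<^sub>1\<close>, this recurrence is Bessel's equation \<open>y g\<^sub>n'' + (n + 1) g\<^sub>n' + g\<^sub>n = 0\<close>.
\<close>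

lemma bessel_clifford_recurrence:
  "y * bessel_clifford (n + 2) y = (real n + 1) * bessel_clifford (n + 1) y - bessel_clifford n y"
proof -
  define c :: "nat \<Rightarrow> nat \<Rightarrow> real" where "c n m = (- 1) ^ m / (fact m * fact (m + n))" for n m
  have g: "(\<lambda>m. c n m * y ^ m) sums bessel_clifford n y" for n
    unfolding c_def bessel_clifford_def using summable_bessel_aux by (rule summable_sums)
  define d where "d m = (real n + 1) * (c (n + 1) m * y ^ m) - c n m * y ^ m" for m
  have c_Suc: "c n m = (real m + real n + 1) * c (n + 1) m" for m
  proof -
    have "fact (m + (n + 1)) = (real m + real n + 1) * fact (m + n)"
      by (simp add: algebra_simps)
    then show ?thesis unfolding c_def by (simp del: fact_Suc)
  qed
  have d_eq: "d m = - real m * c (n + 1) m * y ^ m" for m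
    unfolding d_def c_Suc by (simp add: algebra_simps)
  have shift: "real (Suc m) * c (n + 1) (Suc m) = - c (n + 2) m" for m
    unfolding c_def fact_Suc[of m] power_Suc by (simp del: of_nat_Suc fact_Suc)
  have "d (Suc m) = y * (c (n + 2) m * y ^ m)" for m
    using shift[of m] unfolding d_eq by (simp del: of_nat_Suc)
  then have "(\<lambda>m. d (Suc m)) sums (y * bessel_clifford (n + 2) y)"
    using sums_mult[OF g[of "n + 2"], of y] by simp
  then have "d sums (y * bessel_clifford (n + 2) y)"
    by (subst (asm) sums_Suc_iff) (simp add: d_eq)
  moreover have "d sums ((real n + 1) * bessel_clifford (n + 1) y - bessel_clifford n y)"
    unfolding d_def by (intro sums_diff sums_mult g)
  ultimately show ?thesis by (rule sums_unique2)
qed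

text \<open>
  By Bessel's equation the energy \<open>g\<^sub>n\<^sup>2 + y g\<^sub>n'\<^sup>2\<close> has derivative \<open>- (2 n + 1) g\<^sub>n'\<^sup>2 \<le> 0\<close>, and at
  \<open>y = 0\<close> it equals \<open>g\<^sub>n(0)\<^sup>2\<close>.  In terms of Bessel functions the result says that
  \<open>\<bar>J\<^sub>n(x)\<bar> \<le> (\<bar>x\<bar> / 2)\<^sup>n / n!\<close>.
\<close>

lemma bessel_clifford_bound:
  assumes "0 \<le> y"
  shows "\<bar>bessel_clifford n y\<bar> \<le> 1 / fact n"
proof -
  define E where "E x = (bessel_clifford n x)\<^sup>2 + x * (bessel_clifford (n + 1) x)\<^sup>2" for x
  have "(E has_real_derivative - (2 * real n + 1) * (bessel_clifford (n + 1) x)\<^sup>2) (at x)" for x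
  proof -
    let ?g = "bessel_clifford n x" and ?g' = "bessel_clifford (n + 1) x"
      and ?g'' = "bessel_clifford (n + 2) x"
    have "(E has_real_derivative - 2 * ?g * ?g' + ?g'\<^sup>2 - 2 * ?g' * (x * ?g'')) (at x)"
      unfolding E_def by (auto intro!: derivative_eq_intros simp: power2_eq_square algebra_simps)
    also have "- 2 * ?g * ?g' + ?g'\<^sup>2 - 2 * ?g' * (x * ?g'') = - (2 * real n + 1) * ?g'\<^sup>2"
      unfolding bessel_clifford_recurrence by (simp add: power2_eq_square algebra_simps)
    finally show ?thesis .
  qed
  moreover have "- (2 * real n + 1) * (bessel_clifford (n + 1) x)\<^sup>2 \<le> 0" for x
    by (rule mult_nonpos_nonneg) auto
  ultimately have "E y \<le> E 0"
    by (intro DERIV_nonpos_imp_nonincreasing[OF assms]) blast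
  moreover have "(bessel_clifford n y)\<^sup>2 \<le> E y"
    using assms by (simp add: E_def)
  moreover have "E 0 = (1 / fact n)\<^sup>2"
    by (simp add: E_def)
  ultimately have "(bessel_clifford n y)\<^sup>2 \<le> (1 / fact n)\<^sup>2" by linarith
  then show ?thesis
    by (rule power2_le_imp_le[OF order_trans, rotated]) auto
qed

text \<open>
  The values agree only off \<open>\<nu> = 1\<close>: there division by zero makes the left integrand zero, whereas
  the right one is its continuous extension.
\<close>

lemma bessel_integral_eq_clifford:
  "integral {1..W} (\<lambda>\<nu>. bessel_J 1 (\<beta> * sqrt (\<nu>\<^sup>2 - 1)) / sqrt (\<nu>\<^sup>2 - 1))
    = integral {1..W} (\<lambda>\<nu>. \<beta> / 2 * bessel_clifford 1 (\<beta>\<^sup>2 * (\<nu>\<^sup>2 - 1) / 4))"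
proof (rule integral_spike[of "{1}"])
  fix \<nu> assume "\<nu> \<in> {1..W} - {1}"
  then have "\<nu>\<^sup>2 - 1 > 0" by (auto simp: one_less_power)
  then show "\<beta> / 2 * bessel_clifford 1 (\<beta>\<^sup>2 * (\<nu>\<^sup>2 - 1) / 4)
      = bessel_J 1 (\<beta> * sqrt (\<nu>\<^sup>2 - 1)) / sqrt (\<nu>\<^sup>2 - 1)"
    by (simp add: bessel_J_conv_clifford power_divide power_mult_distrib)
qed simp

text \<open>
  Write \<open>h\<close> for the integrand and \<open>K(\<nu>) = g\<^sub>0(\<beta>\<^sup>2 (\<nu>\<^sup>2 - 1) / 4)\<close>, so that \<open>K' = - \<beta> \<nu> h\<close>.  For a
  constant \<open>c\<close> the function \<open>- (K + c) / (\<beta> \<nu>)\<close> has derivative \<open>h + (K + c) / (\<beta> \<nu>\<^sup>2)\<close>.  As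
  \<open>\<bar>K\<bar> \<le> 1\<close>, this is at least \<open>h\<close> for \<open>c = 1\<close> and at most \<open>h\<close> for \<open>c = - 1\<close>, so the integral of \<open>h\<close>
  is squeezed between two explicit boundary terms.
\<close>

lemma bessel_integral_tail:
  fixes \<beta> :: real
  assumes "\<beta> > 0" "1 \<le> a" "a \<le> b"
  defines "h \<equiv> \<lambda>\<nu>. \<beta> / 2 * bessel_clifford 1 (\<beta>\<^sup>2 * (\<nu>\<^sup>2 - 1) / 4)"
  shows "\<bar>integral {a..b} h\<bar> \<le> 2 / (\<beta> * a)"
proof -
  define K where "K \<nu> = bessel_clifford 0 (\<beta>\<^sup>2 * (\<nu>\<^sup>2 - 1) / 4)" for \<nu>
  have K_bound: "-1 \<le> K \<nu>" "K \<nu> \<le> 1" if "1 \<le> \<nu>" for \<nu>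
    using bessel_clifford_bound[of "\<beta>\<^sup>2 * (\<nu>\<^sup>2 - 1) / 4" 0] that unfolding K_def
    by (auto simp: abs_le_iff)
  have h: "(h has_integral integral {a..b} h) {a..b}"
    unfolding h_def by (intro integrable_integral integrable_continuous_real continuous_intros) auto
  have parts: "((\<lambda>\<nu>. h \<nu> + (K \<nu> + c) / (\<beta> * \<nu>\<^sup>2)) has_integral
      (K a + c) / (\<beta> * a) - (K b + c) / (\<beta> * b)) {a..b}" for c
  proof -
    have "((\<lambda>\<nu>. - (K \<nu> + c) / (\<beta> * \<nu>)) has_real_derivative
        h \<nu> + (K \<nu> + c) / (\<beta> * \<nu>\<^sup>2)) (at \<nu> within {a..b})" if "\<nu> \<in> {a..b}" for \<nu>
    proof -
      have "\<nu> > 0" using that assms by auto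
      then show ?thesis
        using \<open>\<beta> > 0\<close> unfolding K_def h_def
        by (auto intro!: derivative_eq_intros simp: field_simps power2_eq_square)
    qed
    then have "((\<lambda>\<nu>. h \<nu> + (K \<nu> + c) / (\<beta> * \<nu>\<^sup>2)) has_integral
        - (K b + c) / (\<beta> * b) - (- (K a + c) / (\<beta> * a))) {a..b}"
      using \<open>a \<le> b\<close> by (intro fundamental_theorem_of_calculus)
        (auto simp: has_real_derivative_iff_has_vector_derivative)
    also have "- (K b + c) / (\<beta> * b) - (- (K a + c) / (\<beta> * a))
        = (K a + c) / (\<beta> * a) - (K b + c) / (\<beta> * b)"
      by (simp only: minus_divide_left[symmetric])
    finally show ?thesis .
  qed
  have pos: "\<beta> * a > 0" "\<beta> * b > 0" using assms by auto
  have "integral {a..b} h \<le> (K a + 1) / (\<beta> * a) - (K b + 1) / (\<beta> * b)"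
  proof (rule has_integral_le[OF h parts])
    fix \<nu> assume "\<nu> \<in> {a..b}"
    then have "(K \<nu> + 1) / (\<beta> * \<nu>\<^sup>2) \<ge> 0"
      using assms K_bound(1)[of \<nu>] by (intro divide_nonneg_nonneg) auto
    then show "h \<nu> \<le> h \<nu> + (K \<nu> + 1) / (\<beta> * \<nu>\<^sup>2)" by simp
  qed
  also have "\<dots> \<le> (K a + 1) / (\<beta> * a)"
    using K_bound(1)[of b] pos assms by simp
  also have "\<dots> \<le> 2 / (\<beta> * a)"
    using K_bound(2)[of a] pos assms by (intro divide_right_mono) auto
  finally have upper: "integral {a..b} h \<le> 2 / (\<beta> * a)" .
  have "- 2 / (\<beta> * a) \<le> (K a - 1) / (\<beta> * a)"
    using K_bound(1)[of a] pos assms by (intro divide_right_mono) auto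
  also have "\<dots> \<le> (K a - 1) / (\<beta> * a) - (K b - 1) / (\<beta> * b)"
    using K_bound(2)[of b] pos assms by (simp add: divide_nonpos_pos)
  also have "\<dots> \<le> integral {a..b} h"
  proof (rule has_integral_le[OF _ h])
    show "((\<lambda>\<nu>. h \<nu> + (K \<nu> - 1) / (\<beta> * \<nu>\<^sup>2)) has_integral
        (K a - 1) / (\<beta> * a) - (K b - 1) / (\<beta> * b)) {a..b}"
      using parts[of "-1"] by simp
    fix \<nu> assume "\<nu> \<in> {a..b}"
    then have "(K \<nu> - 1) / (\<beta> * \<nu>\<^sup>2) \<le> 0"
      using assms K_bound(2)[of \<nu>] by (intro divide_nonpos_nonneg) auto
    then show "h \<nu> + (K \<nu> - 1) / (\<beta> * \<nu>\<^sup>2) \<le> h \<nu>" by simp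
  qed
  finally show ?thesis using upper by (simp add: abs_le_iff)
qed

text \<open>
  The tail bound alone blows up as \<open>\<beta> \<rightarrow> 0\<close>.  For \<open>\<beta> \<le> 1\<close> it is therefore used only beyond
  \<open>2 / \<beta>\<close>, where it equals \<open>1\<close>; before that point \<open>\<bar>h\<bar> \<le> \<beta> / 2\<close> contributes at most \<open>1\<close> as well.
\<close>

lemma bessel_integral_bound:
  fixes \<beta> :: real
  assumes "\<beta> > 0" "1 \<le> W"
  defines "h \<equiv> \<lambda>\<nu>. \<beta> / 2 * bessel_clifford 1 (\<beta>\<^sup>2 * (\<nu>\<^sup>2 - 1) / 4)"
  shows "\<bar>integral {1..W} h\<bar> \<le> 2 / max 1 \<beta>"
proof (cases "\<beta> \<ge> 1")
  case True
  with bessel_integral_tail[OF \<open>\<beta> > 0\<close> order_refl \<open>1 \<le> W\<close>] show ?thesis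
    unfolding h_def by (simp add: max_def)
next
  case False
  have cont: "continuous_on {p..q} h" for p q
    unfolding h_def by (intro continuous_intros) auto
  have head: "\<bar>integral {1..b} h\<bar> \<le> 1" if "1 \<le> b" "b \<le> 2 / \<beta>" for b
  proof -
    have "norm (h \<nu>) \<le> \<beta> / 2" if "\<nu> \<in> {1..b}" for \<nu>
      using bessel_clifford_bound[of "\<beta>\<^sup>2 * (\<nu>\<^sup>2 - 1) / 4" 1] that assms
      by (simp add: h_def abs_mult)
    with that have "norm (integral {1..b} h) \<le> \<beta> / 2 * (b - 1)"
      by (intro integral_bound cont) auto
    also have "\<dots> \<le> \<beta> / 2 * (2 / \<beta>)"
      using that assms by (intro mult_left_mono) auto
    also have "\<dots> = 1" using assms by simp
    finally show ?thesis by simp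
  qed
  show ?thesis
  proof (cases "W \<le> 2 / \<beta>")
    case True
    with head[of W] \<open>\<not> \<beta> \<ge> 1\<close> \<open>1 \<le> W\<close> show ?thesis by (simp add: max_def)
  next
    case W: False
    have a: "1 \<le> 2 / \<beta>" using False assms by (simp add: field_simps)
    have "integral {1..W} h = integral {1..2 / \<beta>} h + integral {2 / \<beta>..W} h"
      using a W by (intro Henstock_Kurzweil_Integration.integral_combine[symmetric]
          integrable_continuous_real cont) auto
    moreover have "\<bar>integral {2 / \<beta>..W} h\<bar> \<le> 1"
      using bessel_integral_tail[OF \<open>\<beta> > 0\<close> a, of W] W assms unfolding h_def by simp
    ultimately have "\<bar>integral {1..W} h\<bar> \<le> 2"
      using head[OF a order_refl] by linarith
    with False show ?thesis by (simp add: max_def)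
  qed
qed

theorem lemma4p1:
  fixes W \<beta> :: real
  assumes "W > 1" and "\<beta> > 0"
  shows "\<bar>integral {1..W} (\<lambda>\<nu>. bessel_J 1 (\<beta> * sqrt (\<nu>\<^sup>2 - 1)) / sqrt (\<nu>\<^sup>2 - 1))\<bar>
    \<le> (1 - exp (- \<beta>)) / \<beta> + sqrt 2 * pi / sqrt \<beta>"
proof -
  have "sqrt \<beta> \<le> max 1 \<beta>"
    by (rule real_le_lsqrt) (auto simp: max_def power2_eq_square assms)
  then have "2 / max 1 \<beta> \<le> 2 / sqrt \<beta>"
    using assms by (intro divide_left_mono) auto
  also have "2 \<le> sqrt 2 * pi"
    using mult_mono[of 1 "sqrt 2" 2 pi] pi_ge_two by simp
  then have "2 / sqrt \<beta> \<le> sqrt 2 * pi / sqrt \<beta>"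
    using assms by (intro divide_right_mono) auto
  finally have "2 / max 1 \<beta> \<le> sqrt 2 * pi / sqrt \<beta>" .
  moreover have "(1 - exp (- \<beta>)) / \<beta> \<ge> 0"
    using assms by simp
  moreover have "\<bar>integral {1..W} (\<lambda>\<nu>. bessel_J 1 (\<beta> * sqrt (\<nu>\<^sup>2 - 1)) / sqrt (\<nu>\<^sup>2 - 1))\<bar>
      \<le> 2 / max 1 \<beta>"
    unfolding bessel_integral_eq_clifford using assms by (intro bessel_integral_bound) auto
  ultimately show ?thesis by linarith
qed

end
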